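(* Let $G$ be a finite simple graph with $|G|$ vertices and maximum degree $\Delta(G)$. If $\frac{2}{3}|G|-2>\Delta(G)\geq \frac{1}{2}|G|$, then $a_{eq}(G)\leq \left\lceil\frac{\Delta(G)+1}{2}\right\rceil$.
   Context: All graphs are finite, undirected, without loops or multiple edges; $|G|$ denotes the number of vertices of $G$. A graph $G$ admits an equitable $k$-tree-coloring if $V(G)$ can be partitioned into $k$ subsets, each of size $\lceil |G|/k\rceil$ or $\lfloor |G|/k\rfloor$, such that each subset induces a forest in $G$. The equitable vertex arboricity $a_{eq}(G)$ is the minimum integer $k$ such that $G$ has an equitable $k$-tree-coloring. *)

theory Defs
  imports Complex_Main "HOL-Library.Disjoint_Sets" "Graph_Theory.Digraph_Component"
begin

text \<open>
  A finite simple graph is a \<^locale>\<open>graph\<close>: a finite symmetric digraph without loops and parallel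
  arcs, in which the two opposite arcs between u and v together stand for the undirected edge uv.
  Hence the degree of a vertex, i.e. the number of its neighbours, is its out-degree.
\<close>

definition max_degree :: "('a, 'b) pre_digraph \<Rightarrow> nat" where
  "max_degree G = Max (out_degree G ` verts G)"

text \<open>
  The library predicate \<^const>\<open>forest\<close> is not usable here: in a symmetric digraph it already counts
  every edge, traversed back and forth, as a cycle of length 2. The cycles of the undirected graph
  are the directed cycles of length at least 3.
\<close>

definition undirected_forest :: "('a, 'b) pre_digraph \<Rightarrow> bool" where
  "undirected_forest G \<longleftrightarrow> \<not> (\<exists>p. pre_digraph.cycle G p \<and> 3 \<le> length p)"

text \<open>Parts of a partition may be empty; this only occurs if there are more parts than vertices.\<close>

definition equitable_tree_coloring :: "('a, 'b) pre_digraph \<Rightarrow> nat \<Rightarrow> (nat \<Rightarrow> 'a set) \<Rightarrow> bool" where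
  "equitable_tree_coloring G k P \<longleftrightarrow>
     (\<Union>i<k. P i) = verts G \<and> disjoint_family_on P {..<k} \<and>
     (\<forall>i<k. int (card (P i)) = \<lceil>real (card (verts G)) / real k\<rceil> \<or>
            int (card (P i)) = \<lfloor>real (card (verts G)) / real k\<rfloor>) \<and>
     (\<forall>i<k. undirected_forest (G \<restriction> P i))"

definition equitably_tree_colorable :: "('a, 'b) pre_digraph \<Rightarrow> nat \<Rightarrow> bool" where
  "equitably_tree_colorable G k \<longleftrightarrow> 0 < k \<and> (\<exists>P. equitable_tree_coloring G k P)"

definition equitable_vertex_arboricity :: "('a, 'b) pre_digraph \<Rightarrow> nat" where
  "equitable_vertex_arboricity G = (LEAST k. equitably_tree_colorable G k)"

text \<open>The minimum is attained: one may use a color for each vertex.\<close>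

lemma equitably_tree_colorable_card_verts:
  assumes "graph G" and ne: "verts G \<noteq> {}"
  shows "equitably_tree_colorable G (card (verts G))"
proof -
  interpret graph G by fact
  let ?n = "card (verts G)"
  have n: "0 < ?n" using ne by (simp add: card_gt_0_iff)
  obtain f where f: "bij_betw f {..<?n} (verts G)"
    using ex_bij_betw_nat_finite[OF finite_verts] by (auto simp: atLeast0LessThan)
  have forest: "undirected_forest (G \<restriction> {v})" for v
  proof -
    have "arcs (G \<restriction> {v}) = {}"
      by (auto simp: induce_subgraph_def dest: no_loops)
    then have "\<not> pre_digraph.cycle (G \<restriction> {v}) p" for p
      unfolding pre_digraph.cycle_def pre_digraph.awalk_def
      by (metis set_empty subset_empty)
    then show ?thesis by (simp add: undirected_forest_def)
  qed
  have "(\<Union>i<?n. {f i}) = verts G"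
    using f by (auto simp: bij_betw_def)
  moreover have "disjoint_family_on (\<lambda>i. {f i}) {..<?n}"
    using f by (auto simp: bij_betw_def disjoint_family_on_def inj_on_def)
  ultimately have "equitable_tree_coloring G ?n (\<lambda>i. {f i})"
    using n forest by (simp add: equitable_tree_coloring_def)
  with n show ?thesis by (auto simp: equitably_tree_colorable_def)
qed

end

theory Submission
  imports Defs
begin

text \<open>
  Let H be the complement of G, with n vertices and minimum degree at least
  d = n - 1 - \<Delta>(G) > n / 3. Four vertices spanning a path of H induce a forest in G, and so do
  three vertices spanning at least one edge of H. For k = \<lceil>(\<Delta>(G) + 1) / 2\<rceil> the color classes
  have sizes 3 and 4, so it suffices to find in H disjoint paths, b = n - 3 k of them on four vertices
  and a = 4 k - n on two, and to add one of the remaining vertices to each of the latter.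
  Now 4 b + 2 a \<le> 2 d. If a longest path of H has at least 2 d vertices, cut it into pieces.
  Otherwise its vertices lie on a cycle and hence form a component; as d > n / 3, there is only one
  other component, which has a spanning path too, and one can cut these two paths into pieces.
\<close>

section \<open>Longest paths in graphs of given minimum degree\<close>

text \<open>The crossing argument of Dirac's theorem: by maximality all neighbours of both ends lie
  on the path, and two sets of at least \<open>d\<close> positions each must meet among at most
  \<open>2 * d - 1\<close> positions.\<close>

lemma longest_path_crossing:
  assumes sym: "\<And>x y. E x y \<Longrightarrow> E y x"
    and V: "finite V" "set xs \<subseteq> V"
    and path: "distinct xs" "successively E xs" "xs \<noteq> []"
    and longest: "\<And>ys. \<lbrakk>distinct ys; successively E ys; set ys \<subseteq> V\<rbrakk> \<Longrightarrow> length ys \<le> length xs"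
    and irrefl: "\<And>x. \<not> E x x"
    and deg: "\<And>v. v \<in> V \<Longrightarrow> d \<le> card {w \<in> V. E v w}"
    and short: "length xs \<le> 2 * d"
  obtains i where "Suc i < length xs" "E (xs ! 0) (xs ! Suc i)" "E (xs ! i) (xs ! (length xs - 1))"
proof -
  let ?m = "length xs"
  have m: "0 < ?m" using path by simp
  define I where "I = {i. Suc i < ?m \<and> E (xs ! 0) (xs ! Suc i)}"
  define J where "J = {i. Suc i < ?m \<and> E (xs ! i) (xs ! (?m - 1))}"
  have fin: "finite I" "finite J" unfolding I_def J_def
    by (auto intro: finite_subset[of _ "{..<?m}"])
  have hd: "xs ! 0 = hd xs" "xs ! (?m - 1) = last xs"
    using path by (simp_all add: hd_conv_nth last_conv_nth)
  have "y \<in> set xs" if "y \<in> V" "E (xs ! 0) y" for y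
  proof (rule ccontr)
    assume "y \<notin> set xs"
    then show False using longest[of "y # xs"] that path V sym hd
      by (auto simp: successively_Cons)
  qed
  \<comment> \<open>The shift by one records the predecessor of each neighbour of the first vertex;
    irreflexivity rules out position 0.\<close>
  then have "{w \<in> V. E (xs ! 0) w} \<subseteq> (\<lambda>i. xs ! Suc i) ` I"
    unfolding I_def image_def using irrefl m
    by (auto simp: in_set_conv_nth) (metis not0_implies_Suc)
  then have I: "d \<le> card I"
    using deg[of "xs ! 0"] V m fin card_mono[OF finite_imageI[OF fin(1)]] card_image_le[OF fin(1)]
    by (meson nth_mem order_trans subsetD)
  have "y \<in> set xs" if "y \<in> V" "E (xs ! (?m - 1)) y" for y
  proof (rule ccontr)
    assume "y \<notin> set xs"
    then show False using longest[of "xs @ [y]"] that path V hd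
      by (auto simp: successively_append_iff)
  qed
  moreover have "Suc j < ?m" if "j < ?m" "E (xs ! (?m - 1)) (xs ! j)" for j
    using that irrefl by (metis Suc_lessI diff_Suc_1)
  ultimately have "{w \<in> V. E (xs ! (?m - 1)) w} \<subseteq> (\<lambda>i. xs ! i) ` J"
    unfolding J_def image_def using sym by (auto simp: in_set_conv_nth) metis
  then have J: "d \<le> card J"
    using deg[of "xs ! (?m - 1)"] V m fin card_mono[OF finite_imageI[OF fin(2)]] card_image_le[OF fin(2)]
    by (meson nth_mem order_trans subsetD diff_less zero_less_one)
  have "I \<inter> J \<noteq> {}"
  proof
    assume "I \<inter> J = {}"
    then have "2 * d \<le> card (I \<union> J)" using I J fin by (simp add: card_Un_disjoint)
    also have "\<dots> \<le> card {..<?m - 1}"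
      by (rule card_mono) (auto simp: I_def J_def)
    finally show False using short m unfolding card_lessThan by linarith
  qed
  then show ?thesis using that by (auto simp: I_def J_def)
qed

text \<open>The second alternative makes the path span a component of the graph on \<open>V\<close>.
  A longest path satisfies one of the two: a short one closes up to a cycle, and an edge leaving
  that cycle would yield a longer path.\<close>

lemma ex_long_or_closed_path:
  assumes V: "finite V" "V \<noteq> {}"
    and sym: "\<And>x y. E x y \<Longrightarrow> E y x"
    and irrefl: "\<And>x. \<not> E x x"
    and deg: "\<And>v. v \<in> V \<Longrightarrow> d \<le> card {w \<in> V. E v w}"
  obtains xs where "distinct xs" "successively E xs" "set xs \<subseteq> V" "xs \<noteq> []"
    "2 * d < length xs \<or> (\<forall>x\<in>set xs. \<forall>y\<in>V. E x y \<longrightarrow> y \<in> set xs)"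
proof -
  define Q where "Q = (\<lambda>ys. distinct ys \<and> successively E ys \<and> set ys \<subseteq> V)"
  obtain v where v: "v \<in> V" using V by auto
  have "Q [v]" using v by (simp add: Q_def)
  moreover have "\<forall>ys. Q ys \<longrightarrow> length ys < Suc (card V)"
    using V by (auto simp: Q_def less_Suc_eq_le distinct_card[symmetric] intro: card_mono)
  ultimately obtain xs where xs: "Q xs" "\<And>ys. Q ys \<Longrightarrow> length ys \<le> length xs"
    using ex_has_greatest_nat[of Q "[v]" length] by blast
  have ne: "xs \<noteq> []" using xs(2)[OF \<open>Q [v]\<close>] by auto
  have "\<forall>x\<in>set xs. \<forall>y\<in>V. E x y \<longrightarrow> y \<in> set xs" if short: "length xs \<le> 2 * d"
  proof (intro ballI impI, rule ccontr)
    fix x y assume x: "x \<in> set xs" and y: "y \<in> V" "E x y" "y \<notin> set xs"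
    have xs': "distinct xs" "successively E xs" "set xs \<subseteq> V" using xs by (auto simp: Q_def)
    obtain i where i: "Suc i < length xs" "E (xs ! 0) (xs ! Suc i)" "E (xs ! i) (xs ! (length xs - 1))"
      using longest_path_crossing[OF sym V(1) xs'(3,1,2) ne _ irrefl deg short] xs(2)
      unfolding Q_def by blast
    define us where "us = take (Suc i) xs"
    define vs where "vs = drop (Suc i) xs"
    have uv: "xs = us @ vs" "us \<noteq> []" "vs \<noteq> []" using i by (auto simp: us_def vs_def)
    have ends: "last us = xs ! i" "hd vs = xs ! Suc i" "last vs = xs ! (length xs - 1)" "hd us = xs ! 0"
      using i ne last_conv_nth[OF ne] by (simp_all add: us_def vs_def take_Suc_conv_app_nth
          hd_conv_nth hd_drop_conv_nth nth_append)
    have revE: "successively E (rev vs)"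
      using xs' uv by (auto simp: successively_append_iff intro: successively_mono sym)
    \<comment> \<open>Reversing the final segment closes the path up to a cycle, which can be opened next to x.\<close>
    define cs where "cs = us @ rev vs"
    have cs: "successively E cs" "distinct cs" "set cs = set xs" "E (last cs) (hd cs)" "cs \<noteq> []"
      using xs' uv revE ends i(3) sym[OF i(2)]
      by (auto simp: cs_def successively_append_iff hd_rev last_rev)
    obtain as bs where ab: "cs = as @ x # bs" using x cs(3) by (metis split_list)
    \<comment> \<open>The cycle is traversed from \<open>x\<close> through \<open>bs\<close> and
      over the closing edge to \<open>as\<close>; the case split covers \<open>x\<close> at either
      end of \<open>cs\<close>.\<close>
    have "successively E (y # x # bs @ as)"
      using cs(1,4) ab sym[OF y(2)] by (cases "as = []"; cases "bs = []")
        (auto simp: successively_append_iff successively_Cons)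
    moreover have "distinct (y # x # bs @ as)" "set (y # x # bs @ as) \<subseteq> V"
      using cs ab y xs' by auto
    ultimately have "Q (y # x # bs @ as)" by (simp add: Q_def)
    moreover have "length (y # x # bs @ as) = Suc (length xs)"
      using arg_cong[OF ab, of length] uv by (simp add: cs_def)
    ultimately show False using xs(2) by fastforce
  qed
  then have "2 * d < length xs \<or> (\<forall>x\<in>set xs. \<forall>y\<in>V. E x y \<longrightarrow> y \<in> set xs)"
    by (meson not_le)
  then show thesis using that xs ne by (auto simp: Q_def)
qed

section \<open>Packing paths on four and on two vertices\<close>

text \<open>Only the covered set and the two counts are recorded; the paths themselves reappear
  through rule induction.\<close>

inductive path_packing :: "('a \<Rightarrow> 'a \<Rightarrow> bool) \<Rightarrow> 'a set \<Rightarrow> nat \<Rightarrow> nat \<Rightarrow> bool" for E where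
  empty: "path_packing E {} 0 0"
| quad: "\<lbrakk>path_packing E S b a; distinct [w, x, y, z]; {w, x, y, z} \<inter> S = {}; E w x; E x y; E y z\<rbrakk>
    \<Longrightarrow> path_packing E ({w, x, y, z} \<union> S) (Suc b) a"
| pair: "\<lbrakk>path_packing E S b a; x \<noteq> y; {x, y} \<inter> S = {}; E x y\<rbrakk>
    \<Longrightarrow> path_packing E ({x, y} \<union> S) b (Suc a)"

lemma path_packing_finite: "path_packing E S b a \<Longrightarrow> finite S"
  by (induction rule: path_packing.induct) auto

lemma path_packing_card: "path_packing E S b a \<Longrightarrow> card S = 4 * b + 2 * a"
proof (induction rule: path_packing.induct)
  case (quad S b a w x y z)
  then show ?case using path_packing_finite[OF quad(1)] by (subst card_Un_disjoint) auto
next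
  case (pair S b a x y)
  then show ?case using path_packing_finite[OF pair(1)] by (subst card_Un_disjoint) auto
qed auto

lemma path_packing_Un:
  assumes "path_packing E S b a" "path_packing E T b' a'" "S \<inter> T = {}"
  shows "path_packing E (S \<union> T) (b + b') (a + a')"
  using assms
proof (induction rule: path_packing.induct)
  case (quad S b a w x y z)
  then have "path_packing E ({w, x, y, z} \<union> (S \<union> T)) (Suc (b + b')) (a + a')"
    by (intro path_packing.quad) auto
  then show ?case by (simp add: Un_assoc)
next
  case (pair S b a x y)
  then have "path_packing E ({x, y} \<union> (S \<union> T)) (b + b') (Suc (a + a'))"
    by (intro path_packing.pair) auto
  then show ?case by (simp add: Un_assoc)
qed auto

text \<open>Blocks are cut off the front of the path, first those of four vertices, then those of
  two.\<close>

lemma path_packing_of_path_exact: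
  "\<lbrakk>distinct xs; successively E xs; length xs = 4 * b + 2 * a\<rbrakk> \<Longrightarrow> path_packing E (set xs) b a"
proof (induction b arbitrary: xs)
  case 0
  then show ?case
  proof (induction a arbitrary: xs)
    case 0
    then show ?case by (simp add: path_packing.empty)
  next
    case (Suc a)
    then obtain x y ys where xs: "xs = x # y # ys" "length ys = 2 * a"
      by (auto simp: length_Suc_conv)
    have "path_packing E (set ys) 0 a"
      using Suc xs by (auto simp: successively_Cons)
    then have "path_packing E ({x, y} \<union> set ys) 0 (Suc a)"
      using Suc.prems xs by (intro path_packing.pair) auto
    then show ?case using xs by simp
  qed
next
  case (Suc b)
  then obtain w x y z ys where xs: "xs = w # x # y # z # ys" "length ys = 4 * b + 2 * a"
    by (auto simp: length_Suc_conv numeral_eq_Suc)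
  have "path_packing E (set ys) b a"
    using Suc xs by (auto simp: successively_Cons)
  then have "path_packing E ({w, x, y, z} \<union> set ys) (Suc b) a"
    using Suc.prems xs by (intro path_packing.quad) auto
  then show ?case using xs by simp
qed

lemma path_packing_of_path:
  assumes "distinct xs" "successively E xs" "4 * b + 2 * a \<le> length xs"
  obtains S where "S \<subseteq> set xs" "path_packing E S b a"
proof
  let ?ys = "take (4 * b + 2 * a) xs"
  show "set ?ys \<subseteq> set xs" by (rule set_take_subset)
  have "successively E ?ys"
    using assms(2) by (metis append_take_drop_id successively_append_iff)
  then show "path_packing E (set ?ys) b a"
    using assms by (intro path_packing_of_path_exact) auto
qed

text \<open>Blocks are cut greedily from \<open>xs\<close>, and the rest from \<open>ys\<close>. If
  \<open>xs\<close> does not suffice, at most one of its vertices is wasted: when the fours stop for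
  lack of vertices, at most three remain, and \<open>1 \<le> a\<close> lets a pair use two of
  them.\<close>

lemma path_packing_of_two_paths:
  assumes xs: "distinct xs" "successively E xs" and ys: "distinct ys" "successively E ys"
    and disj: "set xs \<inter> set ys = {}"
    and len: "4 * b + 2 * a + 2 \<le> length xs + length ys" and a: "1 \<le> a"
  obtains S where "S \<subseteq> set xs \<union> set ys" "path_packing E S b a"
proof -
  define b1 where "b1 = min b (length xs div 4)"
  define a1 where "a1 = min a ((length xs - 4 * b1) div 2)"
  have le: "b1 \<le> b" "a1 \<le> a" "4 * b1 \<le> length xs" by (auto simp: a1_def b1_def)
  then have 1: "4 * b1 + 2 * a1 \<le> length xs" by (auto simp: a1_def)
  have "length xs \<le> 4 * b1 + 2 * a1 + 1 \<or> (b1 = b \<and> a1 = a)"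
  proof (cases "a1 = a")
    case True
    then show ?thesis
      using a by (cases "b1 = b") (auto simp: b1_def min_def split: if_splits)
  next
    case False
    then have "a1 = (length xs - 4 * b1) div 2" by (simp add: a1_def min_def split: if_splits)
    then show ?thesis by linarith
  qed
  then have 2: "4 * (b - b1) + 2 * (a - a1) \<le> length ys"
    using le len by (elim disjE) auto
  obtain S where S: "S \<subseteq> set xs" "path_packing E S b1 a1"
    using path_packing_of_path[OF xs 1] .
  obtain T where T: "T \<subseteq> set ys" "path_packing E T (b - b1) (a - a1)"
    using path_packing_of_path[OF ys 2] .
  have "path_packing E (S \<union> T) (b1 + (b - b1)) (a1 + (a - a1))"
    using S T disj by (intro path_packing_Un) auto
  moreover have "b1 + (b - b1) = b" "a1 + (a - a1) = a" using le by simp_all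
  ultimately show thesis using S T that[of "S \<union> T"] by auto
qed

text \<open>A set containing a vertex and all its neighbours has at least \<open>d\<close> elements,
  so fewer than \<open>3 * d\<close> vertices leave no room for three disjoint such sets. The bound
  \<open>2 * d + 2 \<le> card V\<close> leaves vertices outside a short path and pays for the slack
  of two in \<open>path_packing_of_two_paths\<close>.\<close>

lemma ex_path_packing:
  assumes V: "finite V"
    and sym: "\<And>x y. E x y \<Longrightarrow> E y x"
    and irrefl: "\<And>x. \<not> E x x"
    and deg: "\<And>v. v \<in> V \<Longrightarrow> d \<le> card {w \<in> V. E v w}"
    and n: "card V < 3 * d" "2 * d + 2 \<le> card V"
    and ab: "4 * b + 2 * a \<le> 2 * d" "1 \<le> a"
  obtains S where "S \<subseteq> V" "path_packing E S b a"
proof -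
  have "V \<noteq> {}" using n by auto
  obtain xs where xs: "distinct xs" "successively E xs" "set xs \<subseteq> V" "xs \<noteq> []"
    and xs': "2 * d < length xs \<or> (\<forall>x\<in>set xs. \<forall>y\<in>V. E x y \<longrightarrow> y \<in> set xs)"
    using ex_long_or_closed_path[OF V \<open>V \<noteq> {}\<close> sym irrefl deg] by blast
  show thesis
  proof (cases "2 * d < length xs")
    case True
    then show thesis using path_packing_of_path[OF xs(1,2), of b a] ab xs(3) that
      by (metis less_imp_le order_trans)
  next
    case False
    then have cl: "y \<in> set xs" if "x \<in> set xs" "y \<in> V" "E x y" for x y
      using xs' that by blast
    define W where "W = V - set xs"
    have W: "finite W" using V by (simp add: W_def)
    \<comment> \<open>No edge joins \<open>set xs\<close> to \<open>W\<close>, so the vertices of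
      \<open>W\<close> keep all their neighbours and hence the degree bound.\<close>
    have nbrs: "{w \<in> W. E v w} = {w \<in> V. E v w}" if "v \<in> W" for v
      using that cl sym by (auto simp: W_def)
    have cardW: "card W = card V - length xs"
      using xs V by (simp add: W_def card_Diff_subset distinct_card)
    have "W \<noteq> {}" using cardW False n by auto
    have degW: "d \<le> card {w \<in> W. E v w}" if "v \<in> W" for v
      using deg[of v] that nbrs[OF that] by (simp add: W_def)
    obtain ys where ys: "distinct ys" "successively E ys" "set ys \<subseteq> W" "ys \<noteq> []"
      and ys': "2 * d < length ys \<or> (\<forall>x\<in>set ys. \<forall>y\<in>W. E x y \<longrightarrow> y \<in> set ys)"
      using ex_long_or_closed_path[OF W \<open>W \<noteq> {}\<close> sym irrefl degW] by blast
    show thesis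
    proof (cases "2 * d < length ys")
      case True
      then show thesis using path_packing_of_path[OF ys(1,2), of b a] ab ys(3) that
        by (metis W_def Diff_subset less_imp_le order_trans)
    next
      case False
      then have cl': "y \<in> set ys" if "x \<in> set ys" "y \<in> W" "E x y" for x y
        using ys' that by blast
      have large: "d \<le> card X" if "X \<subseteq> V" "v \<in> X" "\<And>y. y \<in> V \<Longrightarrow> E v y \<Longrightarrow> y \<in> X" for X v
      proof -
        have "card {w \<in> V. E v w} \<le> card X"
          using that V by (intro card_mono) (auto intro: finite_subset)
        then show ?thesis using deg[of v] that by auto
      qed
      have x: "d \<le> length xs"
        using large[of "set xs" "hd xs"] xs cl by (metis distinct_card list.set_sel(1))
      have y: "d \<le> card (set ys)"
      proof (rule large)
        show "set ys \<subseteq> V" using ys by (auto simp: W_def)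
        show "hd ys \<in> set ys" using ys by simp
        fix y assume "y \<in> V" "E (hd ys) y"
        moreover have "hd ys \<in> W" using ys by auto
        ultimately have "y \<in> W" using nbrs by blast
        then show "y \<in> set ys" using cl' ys \<open>E (hd ys) y\<close> by (meson list.set_sel(1))
      qed
      \<comment> \<open>A vertex missed by both paths has its whole neighbourhood outside them,
        which would give a third set of size at least \<open>d\<close>.\<close>
      have "W = set ys"
      proof (rule ccontr)
        assume "W \<noteq> set ys"
        then obtain z where z: "z \<in> W - set ys" using ys by auto
        have "d \<le> card (W - set ys)"
        proof (rule large)
          show "W - set ys \<subseteq> V" by (auto simp: W_def)
          show "z \<in> W - set ys" by (rule z)
          fix y assume "y \<in> V" "E z y"
          then show "y \<in> W - set ys" using nbrs[of z] z cl' sym by blast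
        qed
        moreover have "card (W - set ys) = card W - card (set ys)"
          using ys by (simp add: card_Diff_subset)
        ultimately show False using x y cardW n by linarith
      qed
      then have "length xs + length ys = card V"
        using cardW xs V ys n by (metis card_mono distinct_card le_add_diff_inverse)
      then obtain S where "S \<subseteq> set xs \<union> set ys" "path_packing E S b a"
        using path_packing_of_two_paths[OF xs(1,2) ys(1,2), of b a] n ab ys by (auto simp: W_def)
      moreover have "set xs \<union> set ys \<subseteq> V" using xs ys by (auto simp: W_def)
      ultimately show thesis using that by blast
    qed
  qed
qed

section \<open>Completing a packing to a partition into classes of four and three vertices\<close>

definition spans_quad :: "('a \<Rightarrow> 'a \<Rightarrow> bool) \<Rightarrow> 'a set \<Rightarrow> bool" where
  "spans_quad E X \<longleftrightarrow> (\<exists>w x y z. X = {w, x, y, z} \<and> distinct [w, x, y, z] \<and> E w x \<and> E x y \<and> E y z)"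

text \<open>The vertex \<open>z\<close> is otherwise unconstrained: when \<open>E\<close> is
  nonadjacency, one such pair already excludes the only possible cycle, a triangle.\<close>

definition spans_pair :: "('a \<Rightarrow> 'a \<Rightarrow> bool) \<Rightarrow> 'a set \<Rightarrow> bool" where
  "spans_pair E X \<longleftrightarrow> (\<exists>x y z. X = {x, y, z} \<and> distinct [x, y, z] \<and> E x y)"

lemma partition_extend:
  assumes "(\<Union>i<m. P i) = V - X" "disjoint_family_on P {..<m}" "\<forall>i<m. Q (P i)"
    and "X \<subseteq> V" "Q X"
  shows "\<exists>P. (\<Union>i<Suc m. P i) = V \<and> disjoint_family_on P {..<Suc m} \<and> (\<forall>i<Suc m. Q (P i))"
proof (intro exI[of _ "P(m := X)"] conjI)
  show "(\<Union>i<Suc m. (P(m := X)) i) = V"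
    using assms by (auto simp: lessThan_Suc)
  have "X \<inter> P i = {}" "P i \<inter> X = {}" if "i < m" for i using assms(1) that by blast+
  then show "disjoint_family_on (P(m := X)) {..<Suc m}"
    using assms(2) by (simp add: disjoint_family_on_def lessThan_Suc)
qed (use assms in \<open>auto simp: less_Suc_eq\<close>)

text \<open>The equation on cardinalities leaves exactly \<open>a\<close> vertices uncovered, one to
  complete each pair to a class of three. The induction removes a finished class from
  \<open>V\<close>, which therefore varies.\<close>

lemma path_packing_partition:
  assumes "path_packing E S b a" "finite V" "S \<subseteq> V" "card V = card S + a"
  shows "\<exists>P. (\<Union>i<b + a. P i) = V \<and> disjoint_family_on P {..<b + a} \<and>
    (\<forall>i<b + a. spans_quad E (P i) \<or> spans_pair E (P i))"
  using assms
proof (induction arbitrary: V rule: path_packing.induct)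
  case empty
  then show ?case by (auto simp: disjoint_family_on_def)
next
  case (quad S b a w x y z)
  let ?X = "{w, x, y, z}"
  have fin: "finite S" using quad.prems by (auto intro: finite_subset)
  have "card (?X \<union> S) = card ?X + card S" using quad.hyps fin by (subst card_Un_disjoint) auto
  moreover have "card (V - ?X) = card V - card ?X" using quad.prems by (intro card_Diff_subset) auto
  ultimately have "card (V - ?X) = card S + a" using quad.prems by simp
  moreover have "S \<subseteq> V - ?X" using quad.prems quad.hyps by auto
  ultimately obtain P where P: "(\<Union>i<b + a. P i) = V - ?X" "disjoint_family_on P {..<b + a}"
    "\<forall>i<b + a. spans_quad E (P i) \<or> spans_pair E (P i)"
    using quad.IH[of "V - ?X"] quad.prems by auto
  have "spans_quad E ?X" unfolding spans_quad_def using quad.hyps by blast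
  then show ?case
    using partition_extend[OF P(1,2), of "\<lambda>X. spans_quad E X \<or> spans_pair E X"] P(3) quad.prems by simp
next
  case (pair S b a x y)
  \<comment> \<open>Here \<open>Suc a\<close> vertices are uncovered, so a spare vertex
    \<open>r\<close> exists.\<close>
  have "card V \<noteq> card ({x, y} \<union> S)" using pair.prems by simp
  then have "{x, y} \<union> S \<noteq> V" by metis
  then obtain r where r: "r \<in> V" "r \<notin> {x, y} \<union> S" using pair.prems(2) by blast
  let ?X = "{x, y, r}"
  have fin: "finite S" using pair.prems by (auto intro: finite_subset)
  have "card ({x, y} \<union> S) = card {x, y} + card S" using pair.hyps fin by (subst card_Un_disjoint) auto
  moreover have "card (V - ?X) = card V - card ?X" using pair.prems r by (intro card_Diff_subset) auto
  moreover have "card ?X = 3" "card {x, y} = 2" using r pair.hyps by auto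
  ultimately have "card (V - ?X) = card S + a" using pair.prems by simp
  moreover have "S \<subseteq> V - ?X" using pair.prems pair.hyps r by auto
  ultimately obtain P where P: "(\<Union>i<b + a. P i) = V - ?X" "disjoint_family_on P {..<b + a}"
    "\<forall>i<b + a. spans_quad E (P i) \<or> spans_pair E (P i)"
    using pair.IH[of "V - ?X"] pair.prems by auto
  have "distinct [x, y, r]" using pair.hyps r by auto
  then have "spans_pair E ?X" unfolding spans_pair_def using pair.hyps by blast
  then show ?case
    using partition_extend[OF P(1,2), of "\<lambda>X. spans_quad E X \<or> spans_pair E X"] P(3) pair.prems r by simp
qed

section \<open>Small induced forests\<close>

text \<open>Adjacency in the complement of \<open>G\<close>. Excluding both arc directions makes the
  relation symmetric for any digraph; it is not confined to \<open>verts G\<close>.\<close>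

definition nonadj :: "('a, 'b) pre_digraph \<Rightarrow> 'a \<Rightarrow> 'a \<Rightarrow> bool" where
  "nonadj G u v \<longleftrightarrow> u \<noteq> v \<and> \<not> u \<rightarrow>\<^bsub>G\<^esub> v \<and> \<not> v \<rightarrow>\<^bsub>G\<^esub> u"

text \<open>Besides itself, \<open>v\<close> loses only its neighbours, at most
  \<open>max_degree G\<close> of them; by symmetry each is the head of an arc out of
  \<open>v\<close>.\<close>

lemma card_nonadj_ge:
  assumes "finite (verts G)" "finite (arcs G)" "symmetric G" and v: "v \<in> verts G"
  shows "card (verts G) - 1 - max_degree G \<le> card {w \<in> verts G. nonadj G v w}"
proof -
  let ?N = "head G ` out_arcs G v"
  have fin: "finite (out_arcs G v)" using assms by (simp add: out_arcs_def)
  have "card ?N \<le> out_degree G v" unfolding out_degree_def using fin by (rule card_image_le)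
  also have "\<dots> \<le> max_degree G" unfolding max_degree_def using assms by (intro Max_ge) auto
  finally have N: "card ?N \<le> max_degree G" .
  have "w \<in> ?N" if "v \<rightarrow>\<^bsub>G\<^esub> w" for w
    using that by (auto simp: arcs_ends_conv)
  then have "verts G - {v} - ?N \<subseteq> {w \<in> verts G. nonadj G v w}"
    using arcs_ends_symmetric[OF assms(3)] by (auto simp: nonadj_def)
  then have "card (verts G - {v} - ?N) \<le> card {w \<in> verts G. nonadj G v w}"
    using assms by (intro card_mono) auto
  moreover have "card (verts G) - 1 - card ?N \<le> card (verts G - {v} - ?N)"
    using diff_card_le_card_Diff[of ?N "verts G - {v}"] fin assms by (simp add: card_Diff_singleton)
  ultimately show ?thesis using N by linarith
qed

text \<open>Reduces acyclicity to a local test: on a cycle of length at least 3 the predecessor and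
  the successor of a vertex are two distinct neighbours of it.\<close>

lemma cycle_two_neighbours:
  assumes cyc: "pre_digraph.cycle (G \<restriction> X) p" and len: "3 \<le> length p"
  obtains C where "C \<noteq> {}" "C \<subseteq> X"
    "\<And>v. v \<in> C \<Longrightarrow> \<exists>x\<in>C. \<exists>y\<in>C. x \<noteq> y \<and> x \<noteq> v \<and> y \<noteq> v \<and> \<not> nonadj G v x \<and> \<not> nonadj G v y"
proof -
  let ?H = "G \<restriction> X"
  let ?l = "length p"
  obtain u where u: "pre_digraph.cas ?H u p u" "set p \<subseteq> arcs ?H"
    "distinct (tl (pre_digraph.awalk_verts ?H u p))"
    using cyc by (auto simp: pre_digraph.cycle_def pre_digraph.awalk_def)
  have ne: "p \<noteq> []" using len by auto
  \<comment> \<open>Indexing the vertices by the heads of the arcs counts the repeated start vertex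
    once.\<close>
  define c where "c i = head G (p ! i)" for i
  \<comment> \<open>Two descriptions of the vertex sequence of the walk; comparing entries
    \<open>Suc i\<close> shows that arc \<open>Suc i\<close> starts where arc \<open>i\<close>
    ends.\<close>
  have verts: "map (tail G) p @ [head G (last p)] = tail G (hd p) # map (head G) p"
    using pre_digraph.awalk_verts_conv[of ?H u p] pre_digraph.awalk_verts_conv'[OF u(1)] ne by simp
  have dist: "distinct (map (head G) p)"
    using u(3) pre_digraph.awalk_verts_conv'[OF u(1)] ne by simp
  have inj: "c i \<noteq> c j" if "i < ?l" "j < ?l" "i \<noteq> j" for i j
    using dist that by (auto simp: distinct_conv_nth c_def)
  have tl_Suc: "tail G (p ! Suc i) = c i" if "Suc i < ?l" for i
    using arg_cong[OF verts, of "\<lambda>xs. xs ! Suc i"] that by (simp add: nth_append c_def)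
  \<comment> \<open>For a closed walk this equates the first tail with the last head, which handles
    the wrap-around.\<close>
  have "pre_digraph.cas ?H u q v \<Longrightarrow> q \<noteq> [] \<Longrightarrow> tail G (hd q) = u \<and> head G (last q) = v" for u q v
    by (induction q arbitrary: u) (auto simp: pre_digraph.cas.simps)
  then have "tail G (hd p) = head G (last p)" using u(1) ne by metis
  then have tl_0: "tail G (p ! 0) = c (?l - 1)"
    using ne by (simp add: c_def hd_conv_nth last_conv_nth)
  have arc: "p ! i \<in> arcs G" "c i \<in> X" if "i < ?l" for i
    using subsetD[OF u(2) nth_mem[OF that]] by (auto simp: c_def)
  have adj: "\<not> nonadj G (tail G (p ! i)) (c i)" "\<not> nonadj G (c i) (tail G (p ! i))" if "i < ?l" for i
    using arc(1)[OF that] by (auto simp: nonadj_def c_def arcs_ends_conv)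
  show thesis
  proof (rule that[of "c ` {..<?l}"])
    show "c ` {..<?l} \<noteq> {}" using ne by (simp add: lessThan_empty_iff)
    show "c ` {..<?l} \<subseteq> X" using arc by auto
    fix v assume "v \<in> c ` {..<?l}"
    then obtain i where i: "i < ?l" "v = c i" by auto
    \<comment> \<open>\<open>j\<close> and \<open>h\<close> are the cyclic successor and predecessor
      of \<open>i\<close>; they differ because the length is at least 3.\<close>
    define j where "j = (if Suc i < ?l then Suc i else 0)"
    define h where "h = (if i = 0 then ?l - 1 else i - 1)"
    have jh: "j < ?l" "h < ?l" "j \<noteq> h" "j \<noteq> i" "h \<noteq> i"
      using i len by (auto simp: j_def h_def)
    have "tail G (p ! j) = c i"
    proof (cases "Suc i < ?l")
      case False
      then have "i = ?l - 1" using i by simp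
      then show ?thesis using tl_0 False by (simp add: j_def)
    qed (simp add: j_def tl_Suc)
    moreover have "tail G (p ! i) = c h"
      using tl_0 tl_Suc[of "i - 1"] i by (auto simp: h_def)
    ultimately have "\<not> nonadj G v (c j)" "\<not> nonadj G v (c h)"
      using adj(1)[OF jh(1)] adj(2)[OF i(1)] i by simp_all
    moreover have "c j \<noteq> c h" "c j \<noteq> v" "c h \<noteq> v" using inj jh i by auto
    ultimately show "\<exists>x\<in>c ` {..<?l}. \<exists>y\<in>c ` {..<?l}.
        x \<noteq> y \<and> x \<noteq> v \<and> y \<noteq> v \<and> \<not> nonadj G v x \<and> \<not> nonadj G v y"
      using jh by blast
  qed
qed

lemma nonadj_sym: "nonadj G u v \<Longrightarrow> nonadj G v u"
  by (auto simp: nonadj_def)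

text \<open>The inner vertices \<open>x\<close> and \<open>y\<close> each have at most one possible
  neighbour in \<open>X\<close>, so neither lies on a cycle; the two ends alone cannot form
  one.\<close>

lemma undirected_forest_spans_quad:
  assumes "spans_quad (nonadj G) X"
  shows "undirected_forest (G \<restriction> X)"
  unfolding undirected_forest_def
proof (intro notI, elim exE conjE)
  fix p assume "pre_digraph.cycle (G \<restriction> X) p" "3 \<le> length p"
  then obtain C where C: "C \<noteq> {}" "C \<subseteq> X" and two:
    "\<And>v. v \<in> C \<Longrightarrow> \<exists>x\<in>C. \<exists>y\<in>C. x \<noteq> y \<and> x \<noteq> v \<and> y \<noteq> v \<and> \<not> nonadj G v x \<and> \<not> nonadj G v y"
    by (rule cycle_two_neighbours) blast
  obtain w x y z where X: "X = {w, x, y, z}" and na: "nonadj G w x" "nonadj G x y" "nonadj G y z"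
    using assms by (auto simp: spans_quad_def)
  note na' = na na[THEN nonadj_sym]
  have sub: "v = w \<or> v = x \<or> v = y \<or> v = z" if "v \<in> C" for v using that C X by auto
  have x: "x \<notin> C" using two[of x] sub na' by metis
  have y: "y \<notin> C" using two[of y] sub na' by metis
  have w: "w \<notin> C" using two[of w] sub x y by metis
  have z: "z \<notin> C" using two[of z] sub x y by metis
  show False using C sub w x y z by auto
qed

text \<open>Within \<open>X\<close>, both \<open>x\<close> and \<open>y\<close> can be adjacent only
  to \<open>z\<close>, so no cycle passes through them.\<close>

lemma undirected_forest_spans_pair:
  assumes "spans_pair (nonadj G) X"
  shows "undirected_forest (G \<restriction> X)"
  unfolding undirected_forest_def
proof (intro notI, elim exE conjE)
  fix p assume "pre_digraph.cycle (G \<restriction> X) p" "3 \<le> length p"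
  then obtain C where C: "C \<noteq> {}" "C \<subseteq> X" and two:
    "\<And>v. v \<in> C \<Longrightarrow> \<exists>x\<in>C. \<exists>y\<in>C. x \<noteq> y \<and> x \<noteq> v \<and> y \<noteq> v \<and> \<not> nonadj G v x \<and> \<not> nonadj G v y"
    by (rule cycle_two_neighbours) blast
  obtain x y z where X: "X = {x, y, z}" and na: "nonadj G x y"
    using assms by (auto simp: spans_pair_def)
  note na' = na na[THEN nonadj_sym]
  have sub: "v = x \<or> v = y \<or> v = z" if "v \<in> C" for v using that C X by auto
  have x: "x \<notin> C" using two[of x] sub na' by metis
  have y: "y \<notin> C" using two[of y] sub na' by metis
  have z: "z \<notin> C" using two[of z] sub x y by metis
  show False using C sub x y z by auto
qed

section \<open>Choice of the parameters and the final bound\<close>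

theorem equitable_vertex_arboricity_le:
  assumes fin: "finite (verts G)" "finite (arcs G)" and sym: "symmetric G"
    and "3 * max_degree G + 6 < 2 * card (verts G)" and "card (verts G) \<le> 2 * max_degree G"
  shows "equitable_vertex_arboricity G \<le> (max_degree G + 2) div 2"
proof -
  define n where "n = card (verts G)"
  define D where "D = max_degree G"
  \<comment> \<open>For natural \<open>D\<close> this is the ceiling of
    \<open>(D + 1) / 2\<close>.\<close>
  define k where "k = (D + 2) div 2"
  have nD: "3 * D + 6 < 2 * n" "n \<le> 2 * D" using assms(4,5) unfolding n_def D_def .
  have kD: "2 * k \<le> D + 2" "D + 1 \<le> 2 * k" unfolding k_def by linarith+
  \<comment> \<open>From \<open>6 * k \<le> 3 * D + 6 < 2 * n\<close> and
    \<open>n \<le> 2 * D < 4 * k\<close>.\<close>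
  have k: "3 * k < n" "n < 4 * k" using nD kD by linarith+
  \<comment> \<open>\<open>b\<close> and \<open>a\<close> solve \<open>4 * b + 3 * a = n\<close> and
    \<open>b + a = k\<close>: they count the classes of four and of three vertices.\<close>
  obtain b where b: "n = 3 * k + b" using k(1) le_Suc_ex less_imp_le by blast
  obtain a where a: "4 * k = n + a" using k(2) le_Suc_ex less_imp_le by blast
  have "D + 1 \<le> n" using nD by linarith
  then obtain d where d: "n = D + 1 + d" using le_Suc_ex by blast
  have arith: "n < 3 * d" "2 * d + 2 \<le> n" "1 \<le> a" using nD d k(2) a by linarith+
  \<comment> \<open>Indeed \<open>4 * b + 2 * a = 2 * n - 4 * k\<close>, while
    \<open>2 * (D + 1) \<le> 4 * k\<close>.\<close>
  have arith': "4 * b + 2 * a \<le> 2 * d" using kD(2) a b d by linarith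
  have deg: "d \<le> card {w \<in> verts G. nonadj G v w}" if "v \<in> verts G" for v
    using card_nonadj_ge[OF fin sym that] by (simp add: n_def[symmetric] D_def[symmetric] d)
  have irrefl: "\<not> nonadj G x x" for x by (simp add: nonadj_def)
  obtain S where S: "S \<subseteq> verts G" "path_packing (nonadj G) S b a"
    using ex_path_packing[OF fin(1) nonadj_sym irrefl deg
        arith(1,2)[unfolded n_def] arith' arith(3)] .
  have "card (verts G) = card S + a"
    using path_packing_card[OF S(2)] a b unfolding n_def[symmetric] by linarith
  moreover have "b + a = k" using a b by linarith
  ultimately obtain P where P: "(\<Union>i<k. P i) = verts G" "disjoint_family_on P {..<k}"
    "\<forall>i<k. spans_quad (nonadj G) (P i) \<or> spans_pair (nonadj G) (P i)"
    using path_packing_partition[OF S(2) fin(1) S(1)] by auto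
  have k0: "0 < real k" using k by simp
  \<comment> \<open>As \<open>n / k\<close> lies strictly between 3 and 4, both class sizes are
    admissible.\<close>
  have "real (3 * k) < real n" "real n < real (4 * k)" using k by (simp_all only: of_nat_less_iff)
  then have "\<lceil>real n / real k\<rceil> = 4" "\<lfloor>real n / real k\<rfloor> = 3"
    using k0 by (simp_all add: ceiling_eq_iff floor_eq_iff field_simps)
  moreover have "card X = 4" if "spans_quad (nonadj G) X" for X
    using that by (auto simp: spans_quad_def)
  moreover have "card X = 3" if "spans_pair (nonadj G) X" for X
    using that by (auto simp: spans_pair_def)
  ultimately have "equitable_tree_coloring G k P"
    using P undirected_forest_spans_quad undirected_forest_spans_pair
    unfolding equitable_tree_coloring_def n_def[symmetric] by (metis of_nat_numeral)
  then have "equitable_vertex_arboricity G \<le> k"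
    unfolding equitable_vertex_arboricity_def equitably_tree_colorable_def
    using k by (intro Least_le) auto
  then show ?thesis by (simp add: k_def D_def)
qed

theorem theorem2p6:
  fixes G :: "('a, 'b) pre_digraph"
  assumes "graph G"
    and "2 / 3 * real (card (verts G)) - 2 > real (max_degree G)"
    and "real (max_degree G) \<ge> 1 / 2 * real (card (verts G))"
  shows "int (equitable_vertex_arboricity G) \<le> \<lceil>(real (max_degree G) + 1) / 2\<rceil>"
proof -
  have "fin_digraph G" "sym_digraph G"
    using assms(1) by (simp_all add: graph_def digraph_def pseudo_graph_def)
  then have G: "finite (verts G)" "finite (arcs G)" "symmetric G"
    by (simp_all add: fin_digraph.finite_verts fin_digraph.finite_arcs sym_digraph.sym_arcs)
  let ?n = "card (verts G)" and ?D = "max_degree G"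
  have "real (3 * ?D + 6) < real (2 * ?n)" "real ?n \<le> real (2 * ?D)"
    using assms(2,3) by simp_all
  then have "3 * ?D + 6 < 2 * ?n" "?n \<le> 2 * ?D" by (simp_all only: of_nat_less_iff of_nat_le_iff)
  then have "equitable_vertex_arboricity G \<le> (?D + 2) div 2"
    by (rule equitable_vertex_arboricity_le[OF G])
  then have "2 * equitable_vertex_arboricity G \<le> ?D + 2" by linarith
  then have "real (2 * equitable_vertex_arboricity G) \<le> real (?D + 2)" by (simp only: of_nat_le_iff)
  \<comment> \<open>An integer is at most the ceiling of \<open>x\<close> iff it is less than
    \<open>x + 1\<close>, so the parity of the degree needs no case split.\<close>
  then show ?thesis by (simp add: le_ceiling_iff)
qed

end
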